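(* For all integers $n\geq 1$ and $q\geq 2$, the Hamming graph satisfies $Z(H(n,q))=\frac{1}{2}\left(q^n+(q-2)^n\right)$.
   Context: The Hamming graph $H(n,q)$ has as vertices all $n$-tuples with entries in $\{0,1,\dots,q-1\}$, two tuples being adjacent if and only if they differ in exactly one coordinate (equivalently, $H(n,q)$ is the Cartesian product of $n$ copies of the complete graph $K_q$). Zero forcing on a graph $G$: start with a set of black vertices, all others white; repeatedly, if a black vertex $v$ has exactly one white neighbor $w$, color $w$ black. A zero forcing set is an initial black set for which this eventually colors all vertices black; $Z(G)$ is the minimum size of a zero forcing set. *)

theory Defs
  imports Complex_Main "Graph_Theory.Pair_Digraph"
begin

definition hamming_graph :: "nat \<Rightarrow> nat \<Rightarrow> nat list pair_pre_digraph" where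
  "hamming_graph n q =
    (let V = {x. length x = n \<and> set x \<subseteq> {0..<q}}
     in \<lparr> pverts = V,
          parcs = {(x, y) \<in> V \<times> V. \<exists>!i. i < n \<and> x ! i \<noteq> y ! i} \<rparr>)"

lemma hamming_graph_simps:
  "pverts (hamming_graph n q) = {x. length x = n \<and> set x \<subseteq> {0..<q}}"
  "(x, y) \<in> parcs (hamming_graph n q) \<longleftrightarrow>
    x \<in> pverts (hamming_graph n q) \<and> y \<in> pverts (hamming_graph n q) \<and>
    (\<exists>!i. i < n \<and> x ! i \<noteq> y ! i)"
  unfolding hamming_graph_def Let_def by simp_all

lemma pair_graph_hamming_graph: "pair_graph (hamming_graph n q)"
proof -
  let ?G = "hamming_graph n q"
  have fin: "finite (pverts ?G)"
    using finite_lists_length_eq[of "{0..<q}" n]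
    unfolding hamming_graph_simps(1) by (simp add: conj_commute)
  have sub: "parcs ?G \<subseteq> pverts ?G \<times> pverts ?G"
    unfolding subset_iff split_paired_All mem_Times_iff fst_conv snd_conv
      hamming_graph_simps(2) by (intro allI impI) (elim conjE, intro conjI)
  have sym: "sym (parcs ?G)"
  proof (rule symI)
    fix x y assume "(x, y) \<in> parcs ?G"
    moreover have "(\<lambda>i. i < n \<and> x ! i \<noteq> y ! i) = (\<lambda>i. i < n \<and> y ! i \<noteq> x ! i)"
      by (rule ext) (rule conj_cong[OF refl], rule neq_commute)
    ultimately show "(y, x) \<in> parcs ?G"
      unfolding hamming_graph_simps(2) by simp
  qed
  have irr: "fst e \<noteq> snd e" if "e \<in> parcs ?G" for e
  proof
    assume "fst e = snd e"
    with that have "(fst e, fst e) \<in> parcs ?G" by (metis prod.collapse)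
    then show False unfolding hamming_graph_simps(2) by blast
  qed
  show ?thesis
  proof unfold_locales
    show "finite (pverts ?G)" by (rule fin)
    show "finite (parcs ?G)"
      by (rule finite_subset[OF sub]) (intro finite_cartesian_product fin)
    show "symmetric (with_proj ?G)"
      using sym unfolding symmetric_def with_proj_simps .
    show "fst e \<in> pverts ?G" "snd e \<in> pverts ?G" "fst e \<noteq> snd e"
      if "e \<in> parcs ?G" for e
      using subsetD[OF sub that] irr[OF that] unfolding mem_Times_iff by blast+
  qed
qed

text \<open>A single colour change: \<open>B\<close> and \<open>B'\<close> are the sets of black vertices before and after.\<close>

definition zero_forcing_step :: "'a pair_pre_digraph \<Rightarrow> 'a set \<Rightarrow> 'a set \<Rightarrow> bool" where
  "zero_forcing_step G B B' \<longleftrightarrow>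
    (\<exists>v \<in> B. \<exists>w. {u \<in> pverts G. (v, u) \<in> parcs G \<and> u \<notin> B} = {w} \<and> B' = insert w B)"

definition zero_forcing_set :: "'a pair_pre_digraph \<Rightarrow> 'a set \<Rightarrow> bool" where
  "zero_forcing_set G S \<longleftrightarrow> S \<subseteq> pverts G \<and> (zero_forcing_step G)\<^sup>*\<^sup>* S (pverts G)"

text \<open>Only meaningful for finite graphs, where \<open>pverts G\<close> itself is a zero forcing set.\<close>

definition zero_forcing_number :: "'a pair_pre_digraph \<Rightarrow> nat" where
  "zero_forcing_number G = (LEAST k. \<exists>S. zero_forcing_set G S \<and> card S = k)"

end

theory Submission
  imports Defs "HOL-Library.FuncSet"
begin

text \<open>
  A function on the vertices that is annihilated by a matrix with the zero pattern of the graph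
  (arbitrary diagonal) and vanishes on a zero forcing set is zero. Over a field of characteristic 2
  choose nonzero weights \<open>v\<^sub>j\<close> with sum 1; the rank one matrix with all rows equal to \<open>v\<close> is then
  idempotent, and so is the sum \<open>A\<close> of its copies acting on the single coordinates, since the cross
  terms cancel. Let \<open>S\<close> consist of the words without letters 0 and 1 and of the words in which 1
  comes before every 0. Idempotence allows every function on \<open>S\<close> to be extended to an element of
  the kernel of \<open>A\<close>. Over the finite field with four elements, where the weights exist for every
  \<open>q \<ge> 2\<close>, counting functions shows that no zero forcing set is smaller than \<open>S\<close>. Conversely
  \<open>S\<close> is zero forcing, because a forcing sequence in dimension \<open>n\<close> can be carried out in all layers
  in parallel.
\<close>

section \<open>Closure under forcing\<close>

text \<open>Records only the outcome of forcing, not an order of steps. As \<open>w\<close> may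
  already be black, forces in different layers combine without any scheduling.\<close>

inductive_set forced :: "'a pair_pre_digraph \<Rightarrow> 'a set \<Rightarrow> 'a set"
  for G S where
  base: "x \<in> S \<Longrightarrow> x \<in> forced G S"
| force: "v \<in> forced G S \<Longrightarrow> (v, w) \<in> parcs G \<Longrightarrow>
    (\<And>u. (v, u) \<in> parcs G \<Longrightarrow> u \<noteq> w \<Longrightarrow> u \<in> forced G S) \<Longrightarrow> w \<in> forced G S"

text \<open>Among the finitely many black sets reachable from \<open>S\<close>, a maximal one admits
  no further step that enlarges it, so it is closed under \<open>force\<close> and contains
  \<open>forced G S\<close>.\<close>

lemma zero_forcing_set_if_forced:
  assumes fin: "finite (pverts G)" and arcs: "parcs G \<subseteq> pverts G \<times> pverts G"
    and S: "S \<subseteq> pverts G" and all: "pverts G \<subseteq> forced G S"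
  shows "zero_forcing_set G S"
proof -
  let ?R = "{B. B \<subseteq> pverts G \<and> (zero_forcing_step G)\<^sup>*\<^sup>* S B}"
  have "finite ?R" using fin by (simp add: finite_subset[of _ "Pow (pverts G)"] Collect_mono)
  moreover have "S \<in> ?R" using S by simp
  ultimately obtain B where B: "B \<in> ?R" "S \<subseteq> B" and max: "\<And>C. C \<in> ?R \<Longrightarrow> B \<subseteq> C \<Longrightarrow> C = B"
    using finite_has_maximal2[of ?R S] by (metis (no_types, lifting))
  have "x \<in> B" if "x \<in> forced G S" for x
    using that
  proof induction
    case (base x)
    then show ?case using B by blast
  next
    case (force v w)
    show ?case
    proof (rule ccontr)
      assume w: "w \<notin> B"
      have "w \<in> pverts G" using force arcs by blast
      moreover have "{u \<in> pverts G. (v, u) \<in> parcs G \<and> u \<notin> B} = {w}"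
        using force w calculation by blast
      then have "zero_forcing_step G B (insert w B)"
        using force unfolding zero_forcing_step_def by blast
      ultimately have "insert w B \<in> ?R"
        using B by (auto intro: rtranclp.rtrancl_into_rtrancl)
      then show False using max w by blast
    qed
  qed
  then have "B = pverts G" using B all by blast
  then show ?thesis using B S unfolding zero_forcing_set_def by blast
qed

section \<open>Hamming graphs by layers\<close>

lemma pverts_hamming_graph_0 [simp]: "pverts (hamming_graph 0 q) = {[]}"
  by (auto simp: hamming_graph_simps(1))

lemma Cons_in_pverts_hamming_graph [simp]:
  "i # xs \<in> pverts (hamming_graph (Suc n) q) \<longleftrightarrow> i < q \<and> xs \<in> pverts (hamming_graph n q)"
  by (auto simp: hamming_graph_simps(1))

lemma pverts_hamming_graph_Suc:
  "pverts (hamming_graph (Suc n) q) = (\<Union>i<q. Cons i ` pverts (hamming_graph n q))"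
  by (auto simp: hamming_graph_simps(1) length_Suc_conv)

lemma finite_pverts_hamming_graph [simp]: "finite (pverts (hamming_graph n q))"
  by (induction n) (simp_all add: pverts_hamming_graph_Suc)

lemma card_pverts_hamming_graph: "card (pverts (hamming_graph n q)) = q ^ n"
  using card_lists_length_eq[of "{0..<q}" n]
  by (simp add: hamming_graph_simps(1) conj_commute)

lemma parcs_hamming_graph_pverts:
  assumes "(x, y) \<in> parcs (hamming_graph n q)"
  shows "x \<in> pverts (hamming_graph n q)" "y \<in> pverts (hamming_graph n q)"
  using assms by (auto simp only: hamming_graph_simps(2))

lemma parcs_hamming_graph_0 [simp]: "parcs (hamming_graph 0 q) = {}"
  by (auto simp: hamming_graph_simps(2))

lemma Ex1_nth_Cons_neq:
  assumes "length xs = n" "length ys = n"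
  shows "(\<exists>!k. k < Suc n \<and> (i # xs) ! k \<noteq> (j # ys) ! k) \<longleftrightarrow>
    (if i = j then \<exists>!k. k < n \<and> xs ! k \<noteq> ys ! k else xs = ys)"
proof (cases "i = j")
  case True
  have "k < Suc n \<and> (i # xs) ! k \<noteq> (j # ys) ! k \<longleftrightarrow>
      (\<exists>l. k = Suc l \<and> l < n \<and> xs ! l \<noteq> ys ! l)" for k
    using True by (cases k) auto
  then show ?thesis using True by auto
next
  case False
  have "k < Suc n \<and> (i # xs) ! k \<noteq> (j # ys) ! k \<longleftrightarrow>
      k = 0 \<or> (\<exists>l. k = Suc l \<and> l < n \<and> xs ! l \<noteq> ys ! l)" for k
    using False by (cases k) auto
  then have "(\<exists>!k. k < Suc n \<and> (i # xs) ! k \<noteq> (j # ys) ! k) \<longleftrightarrow> (\<forall>l<n. xs ! l = ys ! l)"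
    by auto
  then show ?thesis using False assms by (auto intro: nth_equalityI)
qed

text \<open>The Cartesian product structure: a complete graph times the Hamming graph of one
  dimension less. It lets later proofs recurse on words instead of handling indices.\<close>

lemma Cons_Cons_in_parcs_hamming_graph [simp]:
  "(i # xs, j # ys) \<in> parcs (hamming_graph (Suc n) q) \<longleftrightarrow> i < q \<and> j < q \<and>
    (i = j \<and> (xs, ys) \<in> parcs (hamming_graph n q) \<or>
     i \<noteq> j \<and> xs = ys \<and> xs \<in> pverts (hamming_graph n q))"
proof -
  let ?V = "pverts (hamming_graph n q)"
  have len: "length xs = n" if "xs \<in> ?V" for xs
    using that by (simp add: hamming_graph_simps(1))
  show ?thesis
  proof (cases "xs \<in> ?V \<and> ys \<in> ?V")
    case True
    then have "length xs = n" "length ys = n" using len by blast+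
    note ex1 = Ex1_nth_Cons_neq[OF this, of i j]
    show ?thesis
      unfolding hamming_graph_simps(2) Cons_in_pverts_hamming_graph ex1
      using True by (cases "i = j") simp_all
  next
    case False
    then show ?thesis
      unfolding hamming_graph_simps(2) Cons_in_pverts_hamming_graph by blast
  qed
qed

lemma parcs_hamming_graph_ConsE:
  assumes "(i # xs, y) \<in> parcs (hamming_graph (Suc n) q)"
  obtains ys where "y = i # ys" "(xs, ys) \<in> parcs (hamming_graph n q)"
  | j where "y = j # xs" "j \<noteq> i" "j < q" "xs \<in> pverts (hamming_graph n q)"
proof -
  obtain j ys where y: "y = j # ys"
    using parcs_hamming_graph_pverts(2)[OF assms] by (auto simp: pverts_hamming_graph_Suc)
  with assms that show thesis by auto
qed

section \<open>An optimal zero forcing set\<close>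

text \<open>The first letter below 2 decides, if there is one. Exchanging 0 and 1 thus pairs
  accepted with rejected words among those with such a letter, which explains the factor one half in
  the count.\<close>

fun one_before_zero :: "nat list \<Rightarrow> bool" where
  "one_before_zero [] \<longleftrightarrow> True"
| "one_before_zero (i # xs) \<longleftrightarrow> i = 1 \<or> i \<noteq> 0 \<and> one_before_zero xs"

definition initial_set :: "nat \<Rightarrow> nat \<Rightarrow> nat list set" where
  "initial_set n q = {x \<in> pverts (hamming_graph n q). one_before_zero x}"

lemma initial_set_subset: "initial_set n q \<subseteq> pverts (hamming_graph n q)"
  by (auto simp: initial_set_def)

lemma finite_initial_set [simp]: "finite (initial_set n q)"
  by (simp add: initial_set_def)

lemma Cons_in_initial_set [simp]:
  "i # xs \<in> initial_set (Suc n) q \<longleftrightarrow> i < q \<and>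
    (i = 1 \<and> xs \<in> pverts (hamming_graph n q) \<or> i \<noteq> 0 \<and> xs \<in> initial_set n q)"
  by (auto simp: initial_set_def)

text \<open>A first letter 1 leaves the tail free, 0 is excluded, and each of the other q - 2
  letters passes the condition on to the tail.\<close>

lemma card_initial_set:
  assumes "q \<ge> 2"
  shows "2 * card (initial_set n q) = q ^ n + (q - 2) ^ n"
proof (induction n)
  case 0
  have "initial_set 0 q = {[]}" by (auto simp: initial_set_def)
  then show ?case by simp
next
  case (Suc n)
  let ?V = "pverts (hamming_graph n q)" and ?S = "initial_set n q"
  have "initial_set (Suc n) q = Cons 1 ` ?V \<union> (\<Union>i\<in>{2..<q}. Cons i ` ?S)"
  proof (rule set_eqI)
    fix x
    show "x \<in> initial_set (Suc n) q \<longleftrightarrow> x \<in> Cons 1 ` ?V \<union> (\<Union>i\<in>{2..<q}. Cons i ` ?S)"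
    proof (cases x)
      case Nil
      then show ?thesis by (auto simp: initial_set_def hamming_graph_simps(1))
    next
      case (Cons i xs)
      have "i = 0 \<or> i = 1 \<or> 2 \<le> i" by auto
      then show ?thesis
        using Cons assms initial_set_subset[of n q] by (auto simp: image_iff)
    qed
  qed
  moreover have "card (\<Union>i\<in>{2..<q}. Cons i ` ?S) = (\<Sum>i\<in>{2..<q}. card (Cons i ` ?S))"
    by (rule card_UN_disjoint) auto
  then have "card (\<Union>i\<in>{2..<q}. Cons i ` ?S) = (q - 2) * card ?S"
    by (simp add: card_image)
  moreover have "card (Cons 1 ` ?V) = q ^ n"
    by (simp add: card_image card_pverts_hamming_graph)
  moreover have "card (Cons 1 ` ?V \<union> (\<Union>i\<in>{2..<q}. Cons i ` ?S)) =
      card (Cons 1 ` ?V) + card (\<Union>i\<in>{2..<q}. Cons i ` ?S)"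
    by (rule card_Un_disjoint) auto
  ultimately have "2 * card (initial_set (Suc n) q) = 2 * q ^ n + (q - 2) * (2 * card ?S)"
    by simp
  also have "\<dots> = (2 + (q - 2)) * q ^ n + (q - 2) ^ Suc n"
    unfolding Suc.IH by (simp only: add_mult_distrib add_mult_distrib2 power_Suc add.assoc)
  also have "2 + (q - 2) = q" using assms by simp
  finally show ?case by simp
qed

text \<open>Induction on the forcing in the lower dimension, for all layers \<open>i\<close>
  simultaneously: a force there is repeated in each layer. Only copies of initial vertices in layer
  0 need a separate argument.\<close>

lemma Cons_in_forced_initial_set:
  assumes "q \<ge> 2" "xs \<in> forced (hamming_graph n q) (initial_set n q)" "i < q"
  shows "i # xs \<in> forced (hamming_graph (Suc n) q) (initial_set (Suc n) q)"
proof -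
  let ?G = "hamming_graph (Suc n) q" and ?S = "initial_set (Suc n) q"
  have one: "1 # ys \<in> forced ?G ?S" if "ys \<in> pverts (hamming_graph n q)" for ys
    using that assms(1) by (intro forced.base) simp
  \<comment> \<open>Layer 1 is black from the start, so \<open>0 # ys\<close> is the only neighbour
    of \<open>1 # ys\<close> that can still be white.\<close>
  have zero: "0 # ys \<in> forced ?G ?S"
    if ys: "ys \<in> pverts (hamming_graph n q)"
      and oth: "\<And>j. 2 \<le> j \<Longrightarrow> j < q \<Longrightarrow> j # ys \<in> forced ?G ?S" for ys
  proof (rule forced.force[OF one[OF ys]])
    show "(1 # ys, 0 # ys) \<in> parcs ?G" using ys assms(1) by simp
    fix u assume "(1 # ys, u) \<in> parcs ?G" "u \<noteq> 0 # ys"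
    then show "u \<in> forced ?G ?S"
    proof (cases rule: parcs_hamming_graph_ConsE)
      case (1 zs)
      then show ?thesis using one parcs_hamming_graph_pverts(2) by blast
    next
      case (2 j)
      then have "2 \<le> j" using \<open>u \<noteq> 0 # ys\<close> by (cases "j = 0") auto
      then show ?thesis using 2 oth by blast
    qed
  qed
  have letter: "i = 0 \<or> i = 1 \<or> 2 \<le> i" for i :: nat by auto
  show ?thesis
    using assms(2,3)
  proof (induction arbitrary: i)
    case (base ys)
    have ys: "ys \<in> pverts (hamming_graph n q)" using base initial_set_subset by blast
    have oth: "j # ys \<in> forced ?G ?S" if "2 \<le> j" "j < q" for j
      using that base by (intro forced.base) simp
    show ?case using letter[of i] zero[OF ys oth] one[OF ys] oth base by blast
  next
    case (force v w)
    have w: "w \<in> pverts (hamming_graph n q)" and v: "v \<in> pverts (hamming_graph n q)"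
      using force parcs_hamming_graph_pverts by blast+
    \<comment> \<open>Neighbours of \<open>j # v\<close> outside layer \<open>j\<close> are copies
      of \<open>v\<close>, hence black by the induction hypothesis for the other layers.\<close>
    have oth: "j # w \<in> forced ?G ?S" if j: "j < q" for j
    proof (rule forced.force)
      show "j # v \<in> forced ?G ?S" using force j by blast
      show "(j # v, j # w) \<in> parcs ?G" using force j by simp
      fix u assume "(j # v, u) \<in> parcs ?G" "u \<noteq> j # w"
      then show "u \<in> forced ?G ?S"
        using force j by (cases rule: parcs_hamming_graph_ConsE) auto
    qed
    then show ?case using force by blast
  qed
qed

lemma zero_forcing_set_initial_set:
  assumes "q \<ge> 2"
  shows "zero_forcing_set (hamming_graph n q) (initial_set n q)"
proof (rule zero_forcing_set_if_forced)
  show "pverts (hamming_graph n q) \<subseteq> forced (hamming_graph n q) (initial_set n q)"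
  proof (induction n)
    case 0
    then show ?case by (auto simp: initial_set_def intro: forced.base)
  next
    case (Suc n)
    then show ?case
      using Cons_in_forced_initial_set[OF assms] by (auto simp: pverts_hamming_graph_Suc)
  qed
qed (auto simp: initial_set_subset dest: parcs_hamming_graph_pverts)

section \<open>An idempotent operator with the zero pattern of the Hamming graph\<close>

text \<open>The sum of \<open>v j * f y\<close> over all positions and all letters
  \<open>j < q\<close>, where \<open>y\<close> is the word with \<open>j\<close> put at that
  position: a Kronecker sum of rank one matrices. The dimension is the length of the word.\<close>

fun hamming_op :: "(nat \<Rightarrow> 'f::field) \<Rightarrow> nat \<Rightarrow> (nat list \<Rightarrow> 'f) \<Rightarrow> nat list \<Rightarrow> 'f" where
  "hamming_op v q f [] = 0"
| "hamming_op v q f (i # xs) =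
    hamming_op v q (\<lambda>ys. f (i # ys)) xs + (\<Sum>j<q. v j * f (j # xs))"

lemma hamming_op_zero: "hamming_op v q (\<lambda>x. 0) xs = 0"
  by (induction xs) simp_all

lemma hamming_op_add:
  "hamming_op v q (\<lambda>x. f x + g x) xs = hamming_op v q f xs + hamming_op v q g xs"
  by (induction xs arbitrary: f g) (simp_all add: algebra_simps sum.distrib)

lemma hamming_op_mult: "hamming_op v q (\<lambda>x. c * f x) xs = c * hamming_op v q f xs"
  by (induction xs arbitrary: f) (simp_all add: algebra_simps sum_distrib_left)

lemma hamming_op_diff:
  "hamming_op v q (\<lambda>x. f x - g x) xs = hamming_op v q f xs - hamming_op v q g xs"
  using hamming_op_add[of v q f "\<lambda>x. - 1 * g x" xs] hamming_op_mult[of v q "- 1" g xs] by simp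

lemma hamming_op_sum:
  "hamming_op v q (\<lambda>x. \<Sum>j\<in>J. c j * f j x) xs = (\<Sum>j\<in>J. c j * hamming_op v q (f j) xs)"
  by (induction J rule: infinite_finite_induct)
    (simp_all add: hamming_op_zero hamming_op_add hamming_op_mult)

lemma char_2_add_self:
  fixes a :: "'f::field"
  assumes "(1::'f) + 1 = 0"
  shows "a + a = 0"
proof -
  have "a + a = (1 + 1) * a" by (simp only: distrib_right mult_1_left)
  then show ?thesis by (simp only: assms mult_zero_left)
qed

lemma hamming_op_idem:
  fixes v :: "nat \<Rightarrow> 'f::field"
  assumes "(1::'f) + 1 = 0" and "(\<Sum>j<q. v j) = 1"
  shows "hamming_op v q (hamming_op v q f) xs = hamming_op v q f xs"
proof (induction xs arbitrary: f)
  case Nil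
  then show ?case by simp
next
  case (Cons i xs)
  let ?A = "hamming_op v q" and ?f = "\<lambda>j ys. f (j # ys)"
  have "?A (?A f) (i # xs) = ?A (?A (?f i)) xs + (\<Sum>j<q. v j * ?A (?f j) xs) +
      (\<Sum>j<q. v j * (?A (?f j) xs + (\<Sum>k<q. v k * f (k # xs))))"
    by (simp add: hamming_op_add hamming_op_sum)
  \<comment> \<open>The doubled sum consists of the two cross terms between head and tail; the last
    product is the square of the head operator.\<close>
  also have "\<dots> = ?A (?f i) xs + ((\<Sum>j<q. v j * ?A (?f j) xs) + (\<Sum>j<q. v j * ?A (?f j) xs)) +
      (\<Sum>j<q. v j) * (\<Sum>k<q. v k * f (k # xs))"
    by (simp add: Cons.IH distrib_left sum.distrib sum_distrib_right)
  also have "\<dots> = ?A f (i # xs)"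
    using assms by (simp add: char_2_add_self)
  finally show ?case .
qed

text \<open>The matrix row at \<open>x\<close> is supported on \<open>x\<close> and its
  neighbours.\<close>

lemma hamming_op_eq_0:
  assumes "x \<in> pverts (hamming_graph n q)" "f x = 0"
    "\<And>u. (x, u) \<in> parcs (hamming_graph n q) \<Longrightarrow> f u = 0"
  shows "hamming_op v q f x = 0"
  using assms
proof (induction x arbitrary: n f)
  case Nil
  then show ?case by simp
next
  case (Cons i xs)
  obtain m where n: "n = Suc m" using Cons.prems(1) by (cases n) auto
  have "hamming_op v q (\<lambda>ys. f (i # ys)) xs = 0"
    using Cons.prems unfolding n by (intro Cons.IH[of m]) auto
  moreover have "f (j # xs) = 0" if "j < q" for j
    using Cons.prems that unfolding n by (cases "j = i") auto
  ultimately show ?case by simp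
qed

text \<open>An arc determines the coordinate it changes, so \<open>f w\<close> enters through a
  single term, whose coefficient is the weight of the new letter.\<close>

lemma hamming_op_eq_mult:
  assumes "\<And>j. j < q \<Longrightarrow> v j \<noteq> 0" "(x, w) \<in> parcs (hamming_graph n q)" "f x = 0"
    "\<And>u. (x, u) \<in> parcs (hamming_graph n q) \<Longrightarrow> u \<noteq> w \<Longrightarrow> f u = 0"
  shows "\<exists>c. c \<noteq> 0 \<and> hamming_op v q f x = c * f w"
  using assms(2-)
proof (induction x arbitrary: n f w)
  case Nil
  then have "n = 0" by (auto simp: hamming_graph_simps)
  with Nil show ?case by simp
next
  case (Cons i xs)
  have x: "i # xs \<in> pverts (hamming_graph n q)"
    using parcs_hamming_graph_pverts Cons.prems(1) by blast
  then obtain m where n: "n = Suc m" by (cases n) auto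
  have i: "i < q" and xs: "xs \<in> pverts (hamming_graph m q)" using x n by auto
  from Cons.prems(1)[unfolded n] show ?case
  proof (cases rule: parcs_hamming_graph_ConsE)
    case (1 ws)
    have "\<exists>c. c \<noteq> 0 \<and> hamming_op v q (\<lambda>ys. f (i # ys)) xs = c * f (i # ws)"
      using 1 Cons.prems i unfolding n by (intro Cons.IH[of ws m]) auto
    moreover have "f (j # xs) = 0" if "j < q" for j
      using Cons.prems that 1 i xs unfolding n by (cases "j = i") auto
    ultimately show ?thesis using 1 by simp
  next
    case (2 k)
    have "hamming_op v q (\<lambda>ys. f (i # ys)) xs = 0"
      using 2 Cons.prems i xs unfolding n by (intro hamming_op_eq_0[of _ m]) auto
    moreover have "f (j # xs) = 0" if "j < q" "j \<noteq> k" for j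
      using Cons.prems that 2 i xs unfolding n by (cases "j = i") auto
    then have "(\<Sum>j<q. v j * f (j # xs)) = (\<Sum>j\<in>{k}. v j * f (j # xs))"
      using 2 by (intro sum.mono_neutral_right) auto
    ultimately show ?thesis using 2 assms(1) by auto
  qed
qed

text \<open>Induction along the steps: in the kernel equation at the forcing vertex, the value at
  the forced vertex is the only unknown.\<close>

lemma hamming_op_kernel_vanishes:
  fixes v :: "nat \<Rightarrow> 'f::field" and f :: "nat list \<Rightarrow> 'f"
  assumes v: "\<And>j. j < q \<Longrightarrow> v j \<noteq> 0" and T: "zero_forcing_set (hamming_graph n q) T"
    and ker: "\<And>x. x \<in> pverts (hamming_graph n q) \<Longrightarrow> hamming_op v q f x = 0"
    and f: "\<And>x. x \<in> T \<Longrightarrow> f x = 0" and x: "x \<in> pverts (hamming_graph n q)"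
  shows "f x = 0"
proof -
  have "\<forall>x\<in>B. f x = 0" if "(zero_forcing_step (hamming_graph n q))\<^sup>*\<^sup>* T B" for B
    using that
  proof induction
    case base
    then show ?case using f by blast
  next
    case (step B C)
    then obtain u w where u: "u \<in> B" and C: "C = insert w B"
      and w: "{y \<in> pverts (hamming_graph n q). (u, y) \<in> parcs (hamming_graph n q) \<and> y \<notin> B} = {w}"
      unfolding zero_forcing_step_def by blast
    have arc: "(u, w) \<in> parcs (hamming_graph n q)" using w by blast
    have nbr: "f y = 0" if "(u, y) \<in> parcs (hamming_graph n q)" "y \<noteq> w" for y
      using that w step.IH parcs_hamming_graph_pverts(2)[OF that(1)] by blast
    have "\<exists>c. c \<noteq> 0 \<and> hamming_op v q f u = c * f w"
      by (rule hamming_op_eq_mult[OF _ arc]) (use v nbr step.IH u in auto)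
    then have "f w = 0" using ker parcs_hamming_graph_pverts(1)[OF arc] by auto
    then show ?case using C step.IH by blast
  qed
  then show ?thesis using T x unfolding zero_forcing_set_def by blast
qed

lemma hamming_op_kernel_extension:
  fixes v :: "nat \<Rightarrow> 'f::field"
  assumes two: "(1::'f) + 1 = 0" and sum: "(\<Sum>j<q. v j) = 1" and v0: "v 0 \<noteq> 0" and q: "q > 0"
  shows "\<exists>f. (\<forall>x. length x = n \<longrightarrow> hamming_op v q f x = 0) \<and>
    (\<forall>x. length x = n \<longrightarrow> one_before_zero x \<longrightarrow> f x = g x)"
proof (induction n arbitrary: g)
  case 0
  show ?case by (intro exI[of _ g]) simp
next
  case (Suc n)
  let ?A = "hamming_op v q"
  \<comment> \<open>The layers of the extension are \<open>s + e i\<close>, where \<open>s\<close> is fixed by \<open>A\<close> and every \<open>e i\<close> lies in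
    its kernel: layer 1 is prescribed, and layer 0 makes the weighted sum of the \<open>e i\<close> vanish.\<close>
  define s where "s = ?A (\<lambda>ys. g (1 # ys))"
  have "\<exists>f. (\<forall>x. length x = n \<longrightarrow> ?A f x = 0) \<and>
      (\<forall>x. length x = n \<longrightarrow> one_before_zero x \<longrightarrow> f x = g (i # x) - s x)" for i
    by (rule Suc.IH)
  then obtain h where h: "\<And>i x. length x = n \<Longrightarrow> ?A (h i) x = 0"
    "\<And>i x. length x = n \<Longrightarrow> one_before_zero x \<Longrightarrow> h i x = g (i # x) - s x"
    by metis
  define d where "d i = (if i = 1 then (\<lambda>ys. g (1 # ys) - s ys) else h i)" for i
  \<comment> \<open>Words beginning with 0 are never prescribed, so layer 0 is free to be solved
    for, dividing by \<open>v 0\<close>.\<close>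
  define e where "e i = (if i = 0 then (\<lambda>ys. \<Sum>j\<in>{1..<q}. (- v j / v 0) * d j ys) else d i)" for i
  define f where "f x = (case x of [] \<Rightarrow> 0 | i # ys \<Rightarrow> s ys + e i ys)" for x
  have As: "?A s x = s x" for x
    unfolding s_def by (rule hamming_op_idem[OF two sum])
  \<comment> \<open>For layer 1 the function is a difference of the form g - A g, which A kills by
    idempotence.\<close>
  have Ad: "?A (d i) x = 0" if "length x = n" for i x
  proof (cases "i = 1")
    case True
    have "?A (d i) x = ?A (\<lambda>ys. g (1 # ys)) x - ?A s x"
      unfolding d_def using True by (simp add: hamming_op_diff)
    then show ?thesis using As s_def by simp
  next
    case False
    then show ?thesis using h that by (simp add: d_def)
  qed
  have Ae: "?A (e i) x = 0" if "length x = n" for i x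
  proof (cases "i = 0")
    case True
    then have "e i = (\<lambda>ys. \<Sum>j\<in>{1..<q}. (- v j / v 0) * d j ys)" by (simp add: e_def)
    then have "?A (e i) x = (\<Sum>j\<in>{1..<q}. (- v j / v 0) * ?A (d j) x)"
      by (simp only: hamming_op_sum)
    then show ?thesis using Ad[OF that] by simp
  next
    case False
    then show ?thesis using Ad[OF that] by (simp add: e_def)
  qed
  have sum_e: "(\<Sum>j<q. v j * e j x) = 0" for x
  proof -
    have "{..<q} = insert 0 {1..<q}" using q by auto
    then have "(\<Sum>j<q. v j * e j x) = v 0 * e 0 x + (\<Sum>j\<in>{1..<q}. v j * d j x)"
      by (simp add: e_def)
    also have "v 0 * e 0 x = (\<Sum>j\<in>{1..<q}. - (v j * d j x))"
      using v0 by (simp add: e_def sum_distrib_left)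
    finally show ?thesis by (simp add: sum_negf)
  qed
  have "?A f x = 0" if len: "length x = Suc n" for x
  proof -
    obtain i ys where x: "x = i # ys" "length ys = n" using len by (auto simp: length_Suc_conv)
    \<comment> \<open>Both the action inside the layer and the weighted sum across layers contribute
      \<open>s ys\<close>, and the two cancel in characteristic 2.\<close>
    have "?A f x = ?A s ys + ?A (e i) ys + (\<Sum>j<q. v j * (s ys + e j ys))"
      by (simp add: x f_def hamming_op_add)
    also have "(\<Sum>j<q. v j * (s ys + e j ys)) = (\<Sum>j<q. v j) * s ys + (\<Sum>j<q. v j * e j ys)"
      by (simp add: distrib_left sum.distrib sum_distrib_right)
    finally show ?thesis
      using As Ae[OF x(2)] sum_e sum char_2_add_self[OF two] by simp
  qed
  moreover have "f x = g x" if len: "length x = Suc n" and "one_before_zero x" for x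
  proof -
    obtain i ys where "x = i # ys" "length ys = n" using len by (auto simp: length_Suc_conv)
    then show ?thesis using that h(2) by (auto simp: f_def e_def d_def)
  qed
  ultimately show ?case by blast
qed

text \<open>Kernel extensions that agree on \<open>T\<close> differ by a kernel function vanishing
  on \<open>T\<close>, so they coincide. Counting over a finite field replaces a dimension argument,
  so the choice \<open>F\<close> of extensions need not be linear.\<close>

lemma card_initial_set_le:
  fixes v :: "nat \<Rightarrow> 'f::{field,finite}"
  assumes two: "(1::'f) + 1 = 0" and sum: "(\<Sum>j<q. v j) = 1"
    and v: "\<And>j. j < q \<Longrightarrow> v j \<noteq> 0" and q: "q > 0"
    and T: "zero_forcing_set (hamming_graph n q) T"
  shows "card (initial_set n q) \<le> card T"
proof -
  let ?V = "pverts (hamming_graph n q)" and ?S = "initial_set n q"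
  let ?U = "\<lambda>X. X \<rightarrow>\<^sub>E (UNIV :: 'f set)"
  have finT: "finite T"
    using T finite_subset[OF _ finite_pverts_hamming_graph]
    unfolding zero_forcing_set_def by blast
  have "\<exists>f. (\<forall>x\<in>?V. hamming_op v q f x = 0) \<and> (\<forall>x\<in>?S. f x = g x)" for g
  proof -
    obtain f where "\<forall>x. length x = n \<longrightarrow> hamming_op v q f x = 0"
      "\<forall>x. length x = n \<longrightarrow> one_before_zero x \<longrightarrow> f x = g x"
      using hamming_op_kernel_extension[OF two sum v[OF q] q] by blast
    then show ?thesis
      by (intro exI[of _ f]) (auto simp: initial_set_def hamming_graph_simps(1))
  qed
  then obtain F where F: "\<And>g x. x \<in> ?V \<Longrightarrow> hamming_op v q (F g) x = 0"
    "\<And>g x. x \<in> ?S \<Longrightarrow> F g x = g x"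
    by metis
  have "inj_on (\<lambda>g. restrict (F g) T) (?U ?S)"
  proof (rule inj_onI)
    fix g g' assume g: "g \<in> ?U ?S" "g' \<in> ?U ?S" and eq: "restrict (F g) T = restrict (F g') T"
    have T0: "F g x - F g' x = 0" if "x \<in> T" for x
      using fun_cong[OF eq, of x] that by simp
    have "F g x - F g' x = 0" if "x \<in> ?V" for x
      by (rule hamming_op_kernel_vanishes[of q v n T "\<lambda>x. F g x - F g' x"])
        (use v T F(1) T0 that in \<open>auto simp: hamming_op_diff\<close>)
    then have "g x = g' x" if "x \<in> ?S" for x
      using F(2) that initial_set_subset[of n q] by (metis eq_iff_diff_eq_0 subsetD)
    then show "g = g'" by (rule PiE_ext[OF g])
  qed
  then have "card (?U ?S) \<le> card (?U T)"
    by (rule card_inj_on_le) (auto simp: finT intro: finite_PiE)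
  then have "card (UNIV :: 'f set) ^ card ?S \<le> card (UNIV :: 'f set) ^ card T"
    by (simp add: card_PiE finT)
  moreover have "card {0::'f, 1} \<le> card (UNIV :: 'f set)" by (rule card_mono) auto
  then have "1 < card (UNIV :: 'f set)" by simp
  ultimately show ?thesis by simp
qed

section \<open>The field with four elements\<close>

text \<open>\<open>GF4 a b\<close> stands for \<open>a + b \<omega>\<close> with \<open>\<omega>\<^sup>2 = \<omega> + 1\<close>.\<close>

datatype gf4 = GF4 bool bool

instantiation gf4 :: field
begin

definition "0 = GF4 False False"
definition "1 = GF4 True False"
fun plus_gf4 where "GF4 a b + GF4 c d = GF4 (a \<noteq> c) (b \<noteq> d)"
definition "- x = (x::gf4)"
definition "x - y = x + (y::gf4)"
fun times_gf4 where
  "GF4 a b * GF4 c d = GF4 ((a \<and> c) \<noteq> (b \<and> d)) (((a \<and> d) \<noteq> (b \<and> c)) \<noteq> (b \<and> d))"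
text \<open>The nonzero elements form a group of order 3, so squaring inverts them; it also sends 0
  to 0.\<close>

definition "inverse x = x * (x::gf4)"
definition "x div y = x * inverse (y::gf4)"

instance
proof
  fix x y z :: gf4
  have exhaust: "x = GF4 False False \<or> x = GF4 False True \<or> x = GF4 True False \<or> x = GF4 True True"
    for x
  proof (cases x)
    case (GF4 a b)
    then show ?thesis by (cases a; cases b) simp_all
  qed
  show "x * y * z = x * (y * z)"
    using exhaust[of x] exhaust[of y] exhaust[of z] by (elim disjE; hypsubst; simp)
  show "(x + y) * z = x * z + y * z"
    using exhaust[of x] exhaust[of y] exhaust[of z] by (elim disjE; hypsubst; simp)
  show "x + y + z = x + (y + z)"
    using exhaust[of x] exhaust[of y] exhaust[of z] by (elim disjE; hypsubst; simp)
  show "x * y = y * x"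
    using exhaust[of x] exhaust[of y] by (elim disjE; hypsubst; simp)
  show "x + y = y + x"
    using exhaust[of x] exhaust[of y] by (elim disjE; hypsubst; simp)
  show "1 * x = x" "0 + x = x"
    by (cases x; simp add: zero_gf4_def one_gf4_def)+
  show "- x + x = 0"
    by (cases x) (simp add: uminus_gf4_def zero_gf4_def)
  show "x - y = x + - y"
    by (simp add: minus_gf4_def uminus_gf4_def)
  show "(0::gf4) \<noteq> 1"
    by (simp add: zero_gf4_def one_gf4_def)
  show "inverse x * x = 1" if "x \<noteq> 0"
    using that by (cases x) (auto simp: inverse_gf4_def zero_gf4_def one_gf4_def)
  show "x div y = x * inverse y" by (rule divide_gf4_def)
  show "inverse (0::gf4) = 0" by (simp add: inverse_gf4_def zero_gf4_def)
qed

end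

instance gf4 :: finite
proof
  have "x \<in> range (\<lambda>(a, b). GF4 a b)" for x
    by (cases x) auto
  then have "(UNIV :: gf4 set) = range (\<lambda>(a, b). GF4 a b)" by auto
  moreover have "finite (range (\<lambda>(a, b). GF4 a b))" by simp
  ultimately show "finite (UNIV :: gf4 set)" by simp
qed

lemma gf4_one_add_one: "(1::gf4) + 1 = 0"
  by (simp add: one_gf4_def zero_gf4_def del: one_add_one)

text \<open>With two elements all weights would be 1, with sum 0 for even \<open>q\<close>. Here
  \<omega> + (\<omega> + 1) = 1, and for even \<open>q\<close> the remaining q - 2 ones
  cancel.\<close>

lemma gf4_weights:
  assumes "q \<ge> 2"
  obtains v :: "nat \<Rightarrow> gf4" where "\<And>j. v j \<noteq> 0" "(\<Sum>j<q. v j) = 1"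
proof -
  have par: "of_nat m = (if even m then 0 else 1 :: gf4)" for m
    by (induction m) (simp_all add: gf4_one_add_one del: one_add_one)
  show thesis
  proof (cases "even q")
    case False
    then show thesis using par by (intro that[of "\<lambda>_. 1"]) simp_all
  next
    case True
    obtain m where q: "q = Suc (Suc m)" using le_Suc_ex[OF assms] by auto
    let ?v = "\<lambda>j::nat. if j = 0 then GF4 False True else if j = 1 then GF4 True True else 1"
    have "(\<Sum>j<q. ?v j) = GF4 False True + (GF4 True True + (\<Sum>j<m. 1))"
      unfolding q sum.lessThan_Suc_shift by simp
    also have "\<dots> = 1" using par[of m] True q by (simp add: one_gf4_def zero_gf4_def)
    finally show thesis by (intro that[of ?v]) (simp_all add: zero_gf4_def one_gf4_def)
  qed
qed

theorem theorem4p11: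
  fixes n q :: nat
  assumes "n \<ge> 1" and "q \<ge> 2"
  shows "real (zero_forcing_number (hamming_graph n q)) = (real q ^ n + (real q - 2) ^ n) / 2"
proof -
  obtain v :: "nat \<Rightarrow> gf4" where v: "\<And>j. v j \<noteq> 0" "(\<Sum>j<q. v j) = 1"
    using gf4_weights[OF assms(2)] by blast
  have "zero_forcing_number (hamming_graph n q) = card (initial_set n q)"
    unfolding zero_forcing_number_def
  proof (rule Least_equality)
    show "\<exists>S. zero_forcing_set (hamming_graph n q) S \<and> card S = card (initial_set n q)"
      using zero_forcing_set_initial_set[OF assms(2)] by blast
    show "card (initial_set n q) \<le> k"
      if "\<exists>S. zero_forcing_set (hamming_graph n q) S \<and> card S = k" for k
      using that card_initial_set_le[OF gf4_one_add_one v(2) v(1)] assms(2) by auto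
  qed
  moreover have "real (2 * card (initial_set n q)) = real q ^ n + (real q - 2) ^ n"
    unfolding card_initial_set[OF assms(2)] using assms(2) by (simp add: of_nat_diff)
  ultimately show ?thesis by simp
qed

end
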